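(* Let $\Gamma$ be a finitely generated group, $H$ a Hilbert space, and let $(\pi^+,\pi^-)$ be a pair of unitary representations of $\Gamma$ on $H$ such that $\pi^+(g)-\pi^-(g)$ is compact for every $g\in\Gamma$. Let $L_1\subset L_2\subset\cdots$ be an increasing sequence of subspaces of $H$ with $\dim L_n=n$ and $\bigcup_{n\in\mathbb N}L_n$ dense in $H$, and let $P_n$ be the orthogonal projection onto $L_n$. Define $\pi^\pm_n:\Gamma\to\mathbb B(L_n)\cong M_n$ by $\pi^\pm_n(g)=P_n\pi^\pm(g)|_{L_n}$. Then the sequence of pairs $(\pi^+_n,\pi^-_n)_{n\in\mathbb N}$ is asymptotically admissible and asymptotically balanced.
   Context: $M_n$ denotes the $C^*$-algebra of operators on the $n$-dimensional Hilbert space, with the operator norm. For a map $\pi:\Gamma\to M_n$ and $g,h\in\Gamma$ put $M_\pi(g,h)=\pi(gh)-\pi(g)\pi(h)$. Let $F\subset\Gamma$ be finite and $\varepsilon>0$. A pair $(\pi^+,\pi^-)$ of maps $\Gamma\to M_n$ (not assumed to be homomorphisms, nor to take invertible values) satisfying $\pi^\pm(g^{-1})=\pi^\pm(g)^*$ for all $g\in F$ is called: - $(F,\varepsilon)$-admissible if $\|M_{\pi^+}(g,h)(\pi^+(\gamma)-\pi^-(\gamma))\|<\varepsilon$ and $\|M_{\pi^-}(g,h)(\pi^+(\gamma)-\pi^-(\gamma))\|<\varepsilon$ for all $g,h,\gamma\in F$; - $(F,\varepsilon)$-balanced if $\|M_{\pi^+}(g,h)-M_{\pi^-}(g,h)\|<\varepsilon$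 for all $g,h\in F$, and $\|\pi^+(k)M_{\pi^+}(g,h)-\pi^-(k)M_{\pi^-}(g,h)\|<\varepsilon$ for all $g,h,k\in F$. A sequence of pairs of maps $(\pi^+_n,\pi^-_n)_{n\in\mathbb N}$, $\pi_n^\pm:\Gamma\to M_{k_n}$, is asymptotically admissible (resp. asymptotically balanced) if for every finite $F\subset\Gamma$ there are $\varepsilon_n>0$ with $\varepsilon_n\to 0$ as $n\to\infty$ such that $(\pi^+_n,\pi^-_n)$ is $(F,\varepsilon_n)$-admissible (resp. $(F,\varepsilon_n)$-balanced) for every $n$. *)

theory Defs
  imports "HOL-Analysis.Analysis" "HOL-Algebra.Generated_Groups"
begin

section \<open>Complex Hilbert spaces\<close>

class complex_vector = real_vector +
  fixes scaleC :: "complex \<Rightarrow> 'a \<Rightarrow> 'a" (infixr "*\<^sub>C" 75)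
  assumes scaleC_add_right: "a *\<^sub>C (x + y) = a *\<^sub>C x + a *\<^sub>C y"
    and scaleC_add_left: "(a + b) *\<^sub>C x = a *\<^sub>C x + b *\<^sub>C x"
    and scaleC_scaleC: "a *\<^sub>C (b *\<^sub>C x) = (a * b) *\<^sub>C x"
    and scaleC_one: "1 *\<^sub>C x = x"
    and scaleR_scaleC: "r *\<^sub>R x = complex_of_real r *\<^sub>C x"

global_interpretation complex_vector:
  vector_space "scaleC :: complex \<Rightarrow> 'a \<Rightarrow> 'a :: complex_vector"
  by unfold_locales (simp_all add: scaleC_add_right scaleC_add_left scaleC_scaleC scaleC_one)

text \<open>The inner product is linear in its second argument.\<close>

class complex_inner = complex_vector + real_normed_vector +
  fixes cinner :: "'a \<Rightarrow> 'a \<Rightarrow> complex"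
  assumes cinner_commute: "cinner x y = cnj (cinner y x)"
    and cinner_add_right: "cinner x (y + z) = cinner x y + cinner x z"
    and cinner_scaleC_right: "cinner x (c *\<^sub>C y) = c * cinner x y"
    and cinner_ge_zero: "0 \<le> Re (cinner x x)"
    and cinner_eq_zero_iff: "cinner x x = 0 \<longleftrightarrow> x = 0"
    and norm_eq_sqrt_cinner: "norm x = sqrt (Re (cinner x x))"

class chilbert_space = complex_inner + complete_space

definition clinear :: "('h::complex_vector \<Rightarrow> 'h) \<Rightarrow> bool" where
  "clinear T \<longleftrightarrow> Vector_Spaces.linear scaleC scaleC T"

definition unitary_op :: "('h::complex_inner \<Rightarrow> 'h) \<Rightarrow> bool" where
  "unitary_op U \<longleftrightarrow> clinear U \<and> surj U \<and> (\<forall>x y. cinner (U x) (U y) = cinner x y)"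

definition compact_op :: "('h::complex_inner \<Rightarrow> 'h) \<Rightarrow> bool" where
  "compact_op T \<longleftrightarrow> clinear T \<and> compact (closure (T ` cball 0 1))"

definition orth_proj :: "'h::complex_inner set \<Rightarrow> 'h \<Rightarrow> 'h" where
  "orth_proj E x = (THE y. y \<in> E \<and> (\<forall>z\<in>E. cinner z (x - y) = 0))"


section \<open>Groups and unitary representations\<close>

definition finitely_generated :: "('g, 'b) monoid_scheme \<Rightarrow> bool" where
  "finitely_generated G \<longleftrightarrow> (\<exists>S. finite S \<and> S \<subseteq> carrier G \<and> generate G S = carrier G)"

definition unitary_rep :: "('g, 'b) monoid_scheme \<Rightarrow> ('g \<Rightarrow> 'h::complex_inner \<Rightarrow> 'h) \<Rightarrow> bool" where
  "unitary_rep G \<pi> \<longleftrightarrow>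
     (\<forall>g\<in>carrier G. unitary_op (\<pi> g)) \<and>
     (\<forall>g\<in>carrier G. \<forall>h\<in>carrier G. \<pi> (g \<otimes>\<^bsub>G\<^esub> h) = \<pi> g \<circ> \<pi> h)"


section \<open>Operators on finite-dimensional Hilbert spaces\<close>

text \<open>
  The algebra \<open>M\<^sub>n\<close> of operators on the \<open>n\<close>-dimensional Hilbert space is rendered as the algebra
  of operators on an \<open>n\<close>-dimensional subspace \<open>E\<close> of an ambient complex inner product space.
  Such operators are functions on the ambient type of which only the values on \<open>E\<close> are relevant;
  the definitions below never look at the values outside \<open>E\<close>.
\<close>

definition findim_subspace :: "'h::complex_vector set \<Rightarrow> bool" where
  "findim_subspace E \<longleftrightarrow> (\<exists>B. finite B \<and> E = complex_vector.span B)"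

definition operators_on :: "'h::complex_vector set \<Rightarrow> ('h \<Rightarrow> 'h) set" where
  "operators_on E = {T. (\<forall>x\<in>E. T x \<in> E) \<and>
     (\<forall>x\<in>E. \<forall>y\<in>E. T (x + y) = T x + T y) \<and>
     (\<forall>c. \<forall>x\<in>E. T (c *\<^sub>C x) = c *\<^sub>C T x)}"

definition op_norm :: "'h::complex_inner set \<Rightarrow> ('h \<Rightarrow> 'h) \<Rightarrow> real" where
  "op_norm E T = (SUP x\<in>{x\<in>E. norm x \<le> 1}. norm (T x))"

text \<open>
  For operators on a finite-dimensional \<open>E\<close> this determines \<open>S\<close> on \<open>E\<close>, so it says that
  \<open>S\<close> equals the adjoint of \<open>T\<close> taken in the algebra of operators on \<open>E\<close>.
\<close>

definition is_adjoint :: "'h::complex_inner set \<Rightarrow> ('h \<Rightarrow> 'h) \<Rightarrow> ('h \<Rightarrow> 'h) \<Rightarrow> bool" where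
  "is_adjoint E S T \<longleftrightarrow> (\<forall>x\<in>E. \<forall>y\<in>E. cinner (S x) y = cinner x (T y))"

definition compression :: "'h::complex_inner set \<Rightarrow> ('h \<Rightarrow> 'h) \<Rightarrow> 'h \<Rightarrow> 'h" where
  "compression E T = restrict (\<lambda>x. orth_proj E (T x)) E"


section \<open>Admissible and balanced pairs\<close>

definition mult_defect ::
    "('g, 'b) monoid_scheme \<Rightarrow> ('g \<Rightarrow> 'h::complex_vector \<Rightarrow> 'h) \<Rightarrow> 'g \<Rightarrow> 'g \<Rightarrow> 'h \<Rightarrow> 'h" where
  "mult_defect G \<pi> g h = (\<lambda>x. \<pi> (g \<otimes>\<^bsub>G\<^esub> h) x - \<pi> g (\<pi> h x))"

definition operator_pair ::
    "('g, 'b) monoid_scheme \<Rightarrow> 'h::complex_inner set \<Rightarrow> 'g set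
      \<Rightarrow> ('g \<Rightarrow> 'h \<Rightarrow> 'h) \<Rightarrow> ('g \<Rightarrow> 'h \<Rightarrow> 'h) \<Rightarrow> bool" where
  "operator_pair G E F \<pi>p \<pi>m \<longleftrightarrow>
     findim_subspace E \<and>
     (\<forall>g\<in>carrier G. \<pi>p g \<in> operators_on E \<and> \<pi>m g \<in> operators_on E) \<and>
     (\<forall>g\<in>F. is_adjoint E (\<pi>p (inv\<^bsub>G\<^esub> g)) (\<pi>p g) \<and> is_adjoint E (\<pi>m (inv\<^bsub>G\<^esub> g)) (\<pi>m g))"

definition admissible ::
    "('g, 'b) monoid_scheme \<Rightarrow> 'h::complex_inner set \<Rightarrow> 'g set \<Rightarrow> real
      \<Rightarrow> ('g \<Rightarrow> 'h \<Rightarrow> 'h) \<Rightarrow> ('g \<Rightarrow> 'h \<Rightarrow> 'h) \<Rightarrow> bool" where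
  "admissible G E F \<epsilon> \<pi>p \<pi>m \<longleftrightarrow>
     operator_pair G E F \<pi>p \<pi>m \<and>
     (\<forall>g\<in>F. \<forall>h\<in>F. \<forall>\<gamma>\<in>F.
        op_norm E (\<lambda>x. mult_defect G \<pi>p g h (\<pi>p \<gamma> x - \<pi>m \<gamma> x)) < \<epsilon> \<and>
        op_norm E (\<lambda>x. mult_defect G \<pi>m g h (\<pi>p \<gamma> x - \<pi>m \<gamma> x)) < \<epsilon>)"

definition balanced ::
    "('g, 'b) monoid_scheme \<Rightarrow> 'h::complex_inner set \<Rightarrow> 'g set \<Rightarrow> real
      \<Rightarrow> ('g \<Rightarrow> 'h \<Rightarrow> 'h) \<Rightarrow> ('g \<Rightarrow> 'h \<Rightarrow> 'h) \<Rightarrow> bool" where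
  "balanced G E F \<epsilon> \<pi>p \<pi>m \<longleftrightarrow>
     operator_pair G E F \<pi>p \<pi>m \<and>
     (\<forall>g\<in>F. \<forall>h\<in>F.
        op_norm E (\<lambda>x. mult_defect G \<pi>p g h x - mult_defect G \<pi>m g h x) < \<epsilon>) \<and>
     (\<forall>g\<in>F. \<forall>h\<in>F. \<forall>k\<in>F.
        op_norm E (\<lambda>x. \<pi>p k (mult_defect G \<pi>p g h x) - \<pi>m k (mult_defect G \<pi>m g h x)) < \<epsilon>)"

definition asymptotically_admissible ::
    "('g, 'b) monoid_scheme \<Rightarrow> (nat \<Rightarrow> 'h::complex_inner set)
      \<Rightarrow> (nat \<Rightarrow> 'g \<Rightarrow> 'h \<Rightarrow> 'h) \<Rightarrow> (nat \<Rightarrow> 'g \<Rightarrow> 'h \<Rightarrow> 'h) \<Rightarrow> bool" where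
  "asymptotically_admissible G E \<pi>p \<pi>m \<longleftrightarrow>
     (\<forall>F. finite F \<and> F \<subseteq> carrier G \<longrightarrow>
        (\<exists>\<epsilon> :: nat \<Rightarrow> real. (\<forall>n. \<epsilon> n > 0) \<and> \<epsilon> \<longlonglongrightarrow> 0 \<and>
           (\<forall>n. admissible G (E n) F (\<epsilon> n) (\<pi>p n) (\<pi>m n))))"

definition asymptotically_balanced ::
    "('g, 'b) monoid_scheme \<Rightarrow> (nat \<Rightarrow> 'h::complex_inner set)
      \<Rightarrow> (nat \<Rightarrow> 'g \<Rightarrow> 'h \<Rightarrow> 'h) \<Rightarrow> (nat \<Rightarrow> 'g \<Rightarrow> 'h \<Rightarrow> 'h) \<Rightarrow> bool" where
  "asymptotically_balanced G E \<pi>p \<pi>m \<longleftrightarrow>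
     (\<forall>F. finite F \<and> F \<subseteq> carrier G \<longrightarrow>
        (\<exists>\<epsilon> :: nat \<Rightarrow> real. (\<forall>n. \<epsilon> n > 0) \<and> \<epsilon> \<longlonglongrightarrow> 0 \<and>
           (\<forall>n. balanced G (E n) F (\<epsilon> n) (\<pi>p n) (\<pi>m n))))"

end

theory Submission
  imports Defs
begin

text \<open>
  Write \<open>P\<close> for the projection onto \<open>L n\<close>, \<open>Q = 1 - P\<close> and \<open>D g = \<pi>p g - \<pi>m g\<close>. Since a
  representation \<open>\<pi>\<close> is multiplicative, its compression \<open>P \<pi> P\<close> fails to be so exactly by \<open>P (\<pi> g) Q (\<pi> h) P\<close>
  (\<open>mult_defect_compression\<close>). This defect need not become small in norm by itself, but every
  quantity to be estimated is bounded by a sum of norms of terms in which \<open>Q\<close> stands next to a compact operator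
  built from some \<open>D g\<close>, the other factors being contractions.

  It remains to see that \<open>Q K\<close> and \<open>K Q\<close> tend to 0 in norm for such operators \<open>K\<close>. For \<open>Q K\<close> this is
  the uniform convergence of \<open>Q\<close> to 0 on compact sets (\<open>compl_proj_null_on_compact\<close>), a consequence
  of the density of the union of the \<open>L n\<close>. For \<open>K Q\<close> one passes to the adjoint
  (\<open>null_after_compl_proj\<close>); the adjoint of \<open>D g\<close> is \<open>D\<close> at the inverse of \<open>g\<close>, which is
  compact by hypothesis.
  The null sequences for the finitely many group elements in \<open>F\<close> are finally replaced by one
  (\<open>common_null_bound\<close>).
\<close>

section \<open>Geometry of complex inner product spaces\<close>

lemma cinner_add_left: "cinner (x + y) z = cinner x z + cinner (y :: 'a::complex_inner) z"
  by (metis cinner_commute cinner_add_right complex_cnj_add)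

lemma cinner_scaleC_left: "cinner (c *\<^sub>C x) y = cnj c * cinner x (y :: 'a::complex_inner)"
  by (metis cinner_commute cinner_scaleC_right complex_cnj_mult)

lemma cinner_diff_right: "cinner x (y - z) = cinner x y - cinner x (z :: 'a::complex_inner)"
  using cinner_add_right[of x "y - z" z] by simp

lemma cinner_diff_left: "cinner (x - y) z = cinner x z - cinner (y :: 'a::complex_inner) z"
  using cinner_add_left[of "x - y" y z] by simp

lemma cinner_self: "cinner x x = complex_of_real ((norm (x :: 'a::complex_inner))\<^sup>2)"
proof -
  have "Im (cinner x x) = 0"
    using arg_cong[OF cinner_commute[of x x], of Im] by simp
  then show ?thesis
    by (simp add: complex_eq_iff norm_eq_sqrt_cinner cinner_ge_zero)
qed

lemma norm_scaleC: "norm (c *\<^sub>C x) = cmod c * norm (x :: 'a::complex_inner)"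
proof -
  have "complex_of_real ((norm (c *\<^sub>C x))\<^sup>2) = complex_of_real ((cmod c * norm x)\<^sup>2)"
    unfolding cinner_self[symmetric] cinner_scaleC_left cinner_scaleC_right
    by (simp add: cinner_self power_mult_distrib complex_norm_square mult.assoc mult.left_commute
        del: of_real_power)
  then have "(norm (c *\<^sub>C x))\<^sup>2 = (cmod c * norm x)\<^sup>2"
    by (simp only: of_real_eq_iff)
  then show ?thesis by (simp add: power2_eq_iff_nonneg)
qed

lemma pythagoras_cinner:
  assumes "cinner x (y :: 'a::complex_inner) = 0"
  shows "(norm (x + y))\<^sup>2 = (norm x)\<^sup>2 + (norm y)\<^sup>2"
proof -
  have "cinner y x = 0" using assms cinner_commute[of y x] by simp
  then have "cinner (x + y) (x + y) = cinner x x + cinner y y"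
    using assms by (simp add: cinner_add_left cinner_add_right)
  then have "complex_of_real ((norm (x + y))\<^sup>2) = complex_of_real ((norm x)\<^sup>2 + (norm y)\<^sup>2)"
    by (simp only: cinner_self of_real_add)
  then show ?thesis by (simp only: of_real_eq_iff)
qed

lemma norm_le_add_orthogonal:
  assumes "cinner x (y :: 'a::complex_inner) = 0"
  shows "norm x \<le> norm (x + y)" "norm y \<le> norm (x + y)"
  using pythagoras_cinner[OF assms] by (simp_all add: power2_le_imp_le)

lemma orthogonal_component:
  assumes "(e :: 'a::complex_inner) \<noteq> 0"
  shows "cinner e (x - (cinner e x / cinner e e) *\<^sub>C e) = 0"
  using assms by (simp add: cinner_diff_right cinner_scaleC_right cinner_eq_zero_iff)

lemma cauchy_schwarz_cinner: "cmod (cinner x y) \<le> norm x * norm (y :: 'a::complex_inner)"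
proof (cases "x = 0")
  case True
  have "cinner 0 y = 0" using cinner_diff_left[of 0 0 y] by simp
  then show ?thesis using True by simp
next
  case False
  define c where "c = cinner x y / cinner x x"
  have "cinner (c *\<^sub>C x) (y - c *\<^sub>C x) = 0"
    using orthogonal_component[OF False, of y] by (simp add: c_def cinner_scaleC_left)
  from norm_le_add_orthogonal(1)[OF this] have "cmod c * norm x \<le> norm y"
    by (simp add: norm_scaleC)
  moreover have "cmod c = cmod (cinner x y) / (norm x)\<^sup>2"
    by (simp add: c_def cinner_self norm_divide norm_power)
  ultimately show ?thesis using False
    by (simp add: field_simps power2_eq_square)
qed


section \<open>Orthogonal projections onto finite-dimensional subspaces\<close>

lemma subspace_findim: "findim_subspace E \<Longrightarrow> complex_vector.subspace E"
  by (auto simp: findim_subspace_def)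

text \<open>Gram--Schmidt: a new spanning vector \<open>b\<close> contributes only through its component orthogonal
  to the span of the previous ones.\<close>

lemma orth_proj_exists:
  assumes "finite (B :: 'a::complex_inner set)"
  shows "\<exists>y\<in>complex_vector.span B. \<forall>z\<in>complex_vector.span B. cinner z (x - y) = 0"
  using assms
proof (induction B arbitrary: x rule: finite_induct)
  case empty
  have "cinner (0::'a) x = 0" using cinner_diff_left[of 0 0 x] by simp
  then show ?case by simp
next
  case (insert b B)
  let ?S = "complex_vector.span B" and ?S' = "complex_vector.span (insert b B)"
  have sub: "?S \<subseteq> ?S'" by (rule complex_vector.span_mono) blast
  obtain p where p: "p \<in> ?S" "\<And>z. z \<in> ?S \<Longrightarrow> cinner z (b - p) = 0"
    using insert.IH by blast
  obtain q where q: "q \<in> ?S" "\<And>z. z \<in> ?S \<Longrightarrow> cinner z (x - q) = 0"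
    using insert.IH by blast
  define e where "e = b - p"
  have eS': "e \<in> ?S'" unfolding e_def
    by (rule complex_vector.span_diff) (use p sub complex_vector.span_base[of b] in auto)
  have S': "\<exists>k w. z = w + k *\<^sub>C e \<and> w \<in> ?S" if z: "z \<in> ?S'" for z
  proof -
    obtain k where k: "z - k *\<^sub>C b \<in> ?S" using z complex_vector.span_breakdown_eq[of z b B] by blast
    have "z - k *\<^sub>C b + k *\<^sub>C p \<in> ?S"
      by (intro complex_vector.span_add complex_vector.span_scale k p)
    moreover have "z = (z - k *\<^sub>C b + k *\<^sub>C p) + k *\<^sub>C e"
      by (simp add: e_def complex_vector.scale_right_diff_distrib)
    ultimately show ?thesis by blast
  qed
  \<comment> \<open>If \<open>e = 0\<close> then the coefficient is a division by zero, but it multiplies the zero vector.\<close>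
  define c where "c = cinner e x / cinner e e"
  define y where "y = q + c *\<^sub>C e"
  have "y \<in> ?S'" unfolding y_def
    by (intro complex_vector.span_add complex_vector.span_scale eS') (use q sub in auto)
  moreover have "cinner z (x - y) = 0" if z0: "z \<in> ?S'" for z
  proof -
    obtain k w where z: "z = w + k *\<^sub>C e" and w: "w \<in> ?S" using S'[OF z0] by blast
    have we: "cinner v e = 0" if "v \<in> ?S" for v using p(2)[OF that] by (simp add: e_def)
    then have qe: "cinner e q = 0" using q(1) cinner_commute[of e q] by simp
    have "cinner w (x - y) = cinner w (x - q) - c * cinner w e"
      by (simp add: y_def cinner_diff_right cinner_add_right cinner_scaleC_right)
    then have 1: "cinner w (x - y) = 0" using q w we by simp
    have "cinner e (x - y) = cinner e (x - c *\<^sub>C e)"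
      by (simp add: y_def cinner_diff_right cinner_add_right qe)
    also have "\<dots> = 0"
    proof (cases "e = 0")
      case True
      then show ?thesis using cinner_diff_left[of 0 0 x] by simp
    qed (simp add: c_def orthogonal_component)
    finally show ?thesis using 1 by (simp add: z cinner_add_left cinner_scaleC_left)
  qed
  ultimately show ?case by blast
qed

lemma orth_proj_unique:
  assumes "findim_subspace E" "y \<in> E" "\<And>z. z \<in> E \<Longrightarrow> cinner z (x - y) = 0"
  shows "orth_proj E x = y"
  unfolding orth_proj_def
proof (rule the_equality)
  fix y' assume y': "y' \<in> E \<and> (\<forall>z\<in>E. cinner z (x - y') = 0)"
  have d: "y' - y \<in> E"
    using complex_vector.subspace_diff[OF subspace_findim] assms y' by blast
  have "cinner (y' - y) ((x - y) - (x - y')) = 0"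
    unfolding cinner_diff_right[of _ "x - y"] using assms(3)[OF d] y' d by simp
  then show "y' = y" by (simp add: cinner_eq_zero_iff)
qed (use assms in auto)

lemma
  assumes "findim_subspace E"
  shows orth_proj_in: "orth_proj E x \<in> E"
    and orth_proj_orthogonal: "z \<in> E \<Longrightarrow> cinner z (x - orth_proj E x) = 0"
proof -
  obtain y where "y \<in> E" "\<forall>z\<in>E. cinner z (x - y) = 0"
    using orth_proj_exists[of _ x] assms unfolding findim_subspace_def by metis
  moreover from this have "orth_proj E x = y" using assms by (intro orth_proj_unique) auto
  ultimately show "orth_proj E x \<in> E" "z \<in> E \<Longrightarrow> cinner z (x - orth_proj E x) = 0" by auto
qed

lemma orth_proj_add:
  assumes "findim_subspace E"
  shows "orth_proj E (x + y) = orth_proj E x + orth_proj E y"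
proof (rule orth_proj_unique[OF assms])
  show "orth_proj E x + orth_proj E y \<in> E"
    by (intro complex_vector.subspace_add subspace_findim orth_proj_in assms)
  fix z assume "z \<in> E"
  then have "cinner z ((x - orth_proj E x) + (y - orth_proj E y)) = 0"
    by (simp add: cinner_add_right orth_proj_orthogonal assms)
  then show "cinner z (x + y - (orth_proj E x + orth_proj E y)) = 0"
    by (simp add: algebra_simps)
qed

lemma orth_proj_scaleC:
  assumes "findim_subspace E"
  shows "orth_proj E (c *\<^sub>C x) = c *\<^sub>C orth_proj E x"
proof (rule orth_proj_unique[OF assms])
  show "c *\<^sub>C orth_proj E x \<in> E"
    by (intro complex_vector.subspace_scale subspace_findim orth_proj_in assms)
  fix z assume "z \<in> E"
  then have "cinner z (c *\<^sub>C (x - orth_proj E x)) = 0"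
    by (simp add: cinner_scaleC_right orth_proj_orthogonal assms)
  then show "cinner z (c *\<^sub>C x - c *\<^sub>C orth_proj E x) = 0"
    by (simp add: complex_vector.scale_right_diff_distrib)
qed

lemma orth_proj_diff:
  assumes "findim_subspace E"
  shows "orth_proj E (x - y) = orth_proj E x - orth_proj E y"
  using orth_proj_add[OF assms, of "x - y" y] by simp

lemma cinner_orth_proj:
  assumes "findim_subspace E"
  shows "cinner (orth_proj E x) y = cinner x (orth_proj E y)"
proof -
  have "cinner (x - orth_proj E x) (orth_proj E y) = 0"
    using orth_proj_orthogonal[OF assms orth_proj_in[OF assms, of y], of x]
      cinner_commute[of "x - orth_proj E x"] by simp
  moreover have "cinner (orth_proj E x) (y - orth_proj E y) = 0"
    by (intro orth_proj_orthogonal orth_proj_in assms)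
  ultimately show ?thesis by (simp add: cinner_diff_left cinner_diff_right)
qed

lemma norm_orth_proj_le: "findim_subspace E \<Longrightarrow> norm (orth_proj E x) \<le> norm x"
  using norm_le_add_orthogonal(1)[OF orth_proj_orthogonal[OF _ orth_proj_in], of E x x] by simp

abbreviation orth_compl_proj :: "'h::complex_inner set \<Rightarrow> 'h \<Rightarrow> 'h" where
  "orth_compl_proj E x \<equiv> x - orth_proj E x"

text \<open>The projection realises the distance to \<open>E\<close>.\<close>

lemma norm_orth_compl_proj_le_dist:
  assumes "findim_subspace E" "z \<in> E"
  shows "norm (orth_compl_proj E x) \<le> norm (x - z)"
proof -
  have "orth_proj E x - z \<in> E"
    using complex_vector.subspace_diff[OF subspace_findim] assms orth_proj_in by blast
  from norm_le_add_orthogonal(2)[OF orth_proj_orthogonal[OF assms(1) this, of x]]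
  show ?thesis by simp
qed

lemma norm_orth_compl_proj_le:
  "findim_subspace E \<Longrightarrow> norm (orth_compl_proj E x) \<le> norm x"
  using norm_orth_compl_proj_le_dist[of E 0 x] complex_vector.subspace_0[OF subspace_findim, of E]
  by simp

lemma norm_orth_compl_proj_triangle:
  assumes "findim_subspace E"
  shows "norm (orth_compl_proj E (x - y)) \<le> norm (orth_compl_proj E x) + norm y"
proof -
  have "orth_compl_proj E (x - y) = orth_compl_proj E x - orth_compl_proj E y"
    by (simp add: orth_proj_diff assms)
  then show ?thesis
    using norm_triangle_ineq4[of "orth_compl_proj E x" "orth_compl_proj E y"]
      norm_orth_compl_proj_le[OF assms, of y] by (metis add_left_mono order_trans)
qed


section \<open>Operator norms and vanishing sequences\<close>

text \<open>The supremum of a set of reals that is not bounded above is an unspecified real, so even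
  nonnegativity of \<open>op_norm\<close> depends on a bound for \<open>T\<close>.\<close>

lemma abs_op_norm_le:
  assumes "findim_subspace E" "\<And>x. x \<in> E \<Longrightarrow> norm x \<le> 1 \<Longrightarrow> norm (T x) \<le> c"
  shows "\<bar>op_norm E T\<bar> \<le> c"
proof -
  let ?B = "{x \<in> E. norm x \<le> 1}"
  have 0: "0 \<in> ?B" using complex_vector.subspace_0[OF subspace_findim[OF assms(1)]] by simp
  have bdd: "bdd_above ((\<lambda>x. norm (T x)) ` ?B)" using assms(2) by (intro bdd_aboveI) auto
  have "norm (T 0) \<le> op_norm E T"
    unfolding op_norm_def by (rule cSUP_upper[OF 0 bdd])
  moreover have "op_norm E T \<le> c"
    unfolding op_norm_def using 0 assms(2) by (intro cSUP_least) auto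
  ultimately show ?thesis using norm_ge_zero[of "T 0"] by linarith
qed

lemma op_norm_tendsto_0:
  assumes "\<And>n. findim_subspace (E n)"
    and "\<And>n x. x \<in> E n \<Longrightarrow> norm x \<le> 1 \<Longrightarrow> norm (T n x) \<le> c n"
    and "c \<longlonglongrightarrow> 0"
  shows "(\<lambda>n. op_norm (E n) (T n)) \<longlonglongrightarrow> 0"
proof (rule Lim_null_comparison[OF _ assms(3)])
  have "\<bar>op_norm (E n) (T n)\<bar> \<le> c n" for n
    using assms(1,2) by (rule abs_op_norm_le)
  then show "\<forall>\<^sub>F n in sequentially. norm (op_norm (E n) (T n)) \<le> c n" by simp
qed

text \<open>The added term \<open>1 / (n + 1)\<close> makes the common bound strict and positive.\<close>

lemma common_null_bound:
  fixes f :: "'i \<Rightarrow> nat \<Rightarrow> real"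
  assumes "finite I" "\<And>i. i \<in> I \<Longrightarrow> f i \<longlonglongrightarrow> 0"
  shows "\<exists>\<epsilon>. (\<forall>n. \<epsilon> n > 0) \<and> \<epsilon> \<longlonglongrightarrow> 0 \<and> (\<forall>n. \<forall>i\<in>I. f i n < \<epsilon> n)"
proof (intro exI conjI allI ballI)
  let ?\<epsilon> = "\<lambda>n. (\<Sum>i\<in>I. \<bar>f i n\<bar>) + inverse (real (Suc n))"
  show "?\<epsilon> n > 0" for n by (simp add: add_nonneg_pos sum_nonneg)
  have "(\<lambda>n. \<Sum>i\<in>I. \<bar>f i n\<bar>) \<longlonglongrightarrow> (\<Sum>i\<in>I. 0)"
    using assms(2) by (intro tendsto_sum tendsto_rabs_zero)
  from tendsto_add[OF this LIMSEQ_inverse_real_of_nat] show "?\<epsilon> \<longlonglongrightarrow> 0" by simp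
  show "f i n < ?\<epsilon> n" if "i \<in> I" for i n
    using member_le_sum[OF that, of "\<lambda>i. \<bar>f i n\<bar>"] assms(1)
    by (smt (verit) abs_ge_zero abs_ge_self inverse_positive_iff_positive of_nat_0_less_iff zero_less_Suc)
qed


section \<open>Compactness kills the orthogonal complements\<close>

locale dense_filtration =
  fixes L :: "nat \<Rightarrow> 'h::complex_inner set"
  assumes findim: "findim_subspace (L n)"
    and L_Suc: "L n \<subseteq> L (Suc n)"
    and dense: "closure (\<Union>n. L n) = UNIV"
begin

abbreviation P where "P n \<equiv> orth_proj (L n)"
abbreviation Q where "Q n \<equiv> orth_compl_proj (L n)"

lemma L_mono: "m \<le> n \<Longrightarrow> L m \<subseteq> L n"
  using lift_Suc_mono_le[of L] L_Suc by blast

text \<open>By density the balls of radius \<open>e\<close> about the points of the \<open>L n\<close> cover the compact set;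
  the finitely many centres of a subcover lie in one \<open>L N\<close>, and then every point of the compact set
  is within \<open>e\<close> of every later subspace.\<close>

lemma compact_uniformly_approximated:
  assumes "compact C" "e > 0"
  shows "\<exists>N. \<forall>n\<ge>N. \<forall>y\<in>C. norm (Q n y) \<le> e"
proof -
  have cover: "C \<subseteq> \<Union> ((\<lambda>z. ball z e) ` (\<Union>n. L n))"
  proof
    fix y
    have "y \<in> closure (\<Union>n. L n)" by (simp add: dense)
    then show "y \<in> \<Union> ((\<lambda>z. ball z e) ` (\<Union>n. L n))"
      using closure_approachable[of y "\<Union>n. L n"] \<open>e > 0\<close> by (auto simp del: UN_iff)
  qed
  then obtain Z where Z: "Z \<subseteq> (\<Union>n. L n)" "finite Z" "C \<subseteq> (\<Union>z\<in>Z. ball z e)"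
    using compactE_image[OF \<open>compact C\<close>, of "\<Union>n. L n" "\<lambda>z. ball z e"] by (metis open_ball)
  obtain i where i: "\<And>z. z \<in> Z \<Longrightarrow> z \<in> L (i z)" using Z(1) by (metis UN_E subsetD)
  obtain N where N: "\<And>z. z \<in> Z \<Longrightarrow> i z \<le> N"
    using finite_nat_set_iff_bounded_le[of "i ` Z"] Z(2) by auto
  have "norm (Q n y) \<le> e" if n: "n \<ge> N" and y: "y \<in> C" for n y
  proof -
    obtain z where z: "z \<in> Z" "dist z y < e" using Z(3) y by auto
    then have "z \<in> L n" using i N L_mono n by (meson le_trans subsetD)
    from norm_orth_compl_proj_le_dist[OF findim this, of y] show ?thesis
      using z by (simp add: dist_norm norm_minus_commute)
  qed
  then show ?thesis by blast
qed

lemma compl_proj_null_on_compact: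
  assumes "compact C"
  obtains \<delta> where "\<delta> \<longlonglongrightarrow> 0" "\<And>n y. y \<in> C \<Longrightarrow> norm (Q n y) \<le> \<delta> n"
proof (cases "C = {}")
  case True
  then show ?thesis using that[of "\<lambda>_. 0"] by simp
next
  case False
  define \<delta> where "\<delta> n = (SUP y\<in>C. norm (Q n y))" for n
  obtain b where b: "\<And>y. y \<in> C \<Longrightarrow> norm y \<le> b"
    using compact_imp_bounded[OF assms] bounded_iff by metis
  have upper: "norm (Q n y) \<le> \<delta> n" if "y \<in> C" for n y
    unfolding \<delta>_def
  proof (rule cSUP_upper[OF that])
    show "bdd_above ((\<lambda>y. norm (Q n y)) ` C)"
      using b norm_orth_compl_proj_le[OF findim] by (intro bdd_aboveI2[of _ _ b]) (meson order_trans)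
  qed
  have "\<delta> \<longlonglongrightarrow> 0"
  proof (rule LIMSEQ_I)
    fix e :: real assume "e > 0"
    then obtain N where N: "\<And>n y. n \<ge> N \<Longrightarrow> y \<in> C \<Longrightarrow> norm (Q n y) \<le> e / 2"
      using compact_uniformly_approximated[OF assms, of "e / 2"] by auto
    have "norm (\<delta> n - 0) < e" if "n \<ge> N" for n
    proof -
      obtain y where "y \<in> C" using False by blast
      then have "0 \<le> \<delta> n" using upper norm_ge_zero order_trans by blast
      moreover have "\<delta> n \<le> e / 2"
        unfolding \<delta>_def using False N that by (intro cSUP_least) auto
      ultimately show ?thesis using \<open>e > 0\<close> by simp
    qed
    then show "\<exists>N. \<forall>n\<ge>N. norm (\<delta> n - 0) < e" by blast
  qed
  then show ?thesis using that upper by blast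
qed

text \<open>Since \<open>K Q\<close> is the adjoint of \<open>Q K\<^sup>*\<close>, its norm vanishes as soon as the adjoint \<open>K'\<close> of
  \<open>K\<close> is compact.\<close>

lemma null_after_compl_proj:
  assumes "compact C" "\<And>x. norm x \<le> 1 \<Longrightarrow> K' x \<in> C"
    and adj: "\<And>x y. cinner (K x) y = cinner x (K' y)"
  obtains \<delta> where "\<delta> \<longlonglongrightarrow> 0" "\<And>n x. norm x \<le> 1 \<Longrightarrow> norm (K (Q n x)) \<le> \<delta> n"
proof -
  obtain \<delta> where \<delta>: "\<delta> \<longlonglongrightarrow> 0" "\<And>n y. y \<in> C \<Longrightarrow> norm (Q n y) \<le> \<delta> n"
    using compl_proj_null_on_compact[OF assms(1)] by blast
  have "norm (K (Q n x)) \<le> \<delta> n" if x: "norm x \<le> 1" for n x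
  proof (cases "K (Q n x) = 0")
    case True
    have "0 \<le> norm (Q n (K' 0))" by simp
    also have "\<dots> \<le> \<delta> n" using assms(2) by (intro \<delta>(2)) simp
    finally show ?thesis using True by simp
  next
    case False
    define y where "y = K (Q n x)"
    \<comment> \<open>The norm of \<open>y\<close> is its inner product with the unit vector in its own direction.\<close>
    define u where "u = complex_of_real (1 / norm y) *\<^sub>C y"
    have y0: "norm y \<noteq> 0" using False by (simp add: y_def)
    have u: "norm u = 1" using y0 by (simp add: u_def norm_scaleC norm_divide)
    have "cinner y u = complex_of_real (norm y)"
      using y0 by (simp add: u_def cinner_scaleC_right cinner_self power2_eq_square)
    then have "norm y = cmod (cinner y u)" by simp
    also have "cinner y u = cinner (Q n x) (K' u)" by (simp add: y_def adj)
    also have "\<dots> = cinner x (Q n (K' u))"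
      by (simp add: cinner_diff_left cinner_diff_right cinner_orth_proj findim)
    also have "cmod \<dots> \<le> norm x * norm (Q n (K' u))" by (rule cauchy_schwarz_cinner)
    also have "\<dots> \<le> 1 * norm (Q n (K' u))" by (rule mult_right_mono) (use x in auto)
    also have "\<dots> \<le> \<delta> n" using \<delta>(2) assms(2) u by simp
    finally show ?thesis by (simp add: y_def)
  qed
  then show ?thesis using that \<delta>(1) by blast
qed

end

lemma findim_of_dim:
  assumes sub: "\<And>n. complex_vector.subspace (L n :: 'a::complex_vector set)"
    and dim: "\<And>n. complex_vector.dim (L n) = n"
    and Suc: "\<And>n. L n \<subseteq> L (Suc n)"
  shows "findim_subspace (L n)"
proof -
  have span_basis: "\<exists>B. L n = complex_vector.span B \<and> complex_vector.independent B \<and> card B = n" for n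
    using complex_vector.basis_exists[of "L n"] dim[of n]
      complex_vector.span_subspace[OF _ _ sub[of n]] by metis
  \<comment> \<open>Infinite sets have cardinality 0, so \<open>dim (L n) = n\<close> makes a basis finite only for positive
    \<open>n\<close>; passing to \<open>L (Suc n)\<close> treats all \<open>n\<close> alike.\<close>
  obtain B where B: "L n = complex_vector.span B" "complex_vector.independent B"
    using span_basis by blast
  obtain B' where B': "L (Suc n) = complex_vector.span B'" "card B' = Suc n"
    using span_basis by blast
  have "finite B'" using B'(2) card.infinite by fastforce
  moreover have "B \<subseteq> complex_vector.span B'"
    using Suc[of n] B(1) B'(1) complex_vector.span_superset by blast
  ultimately have "finite B"
    using complex_vector.independent_span_bound B(2) by blast
  then show ?thesis using B(1) unfolding findim_subspace_def by blast
qed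


section \<open>Unitary representations and their compressions\<close>

lemma unitary_op_norm: "unitary_op U \<Longrightarrow> norm (U x) = norm x"
  by (simp add: unitary_op_def norm_eq_sqrt_cinner)

lemma
  assumes "unitary_op U"
  shows unitary_op_add: "U (x + y) = U x + U y"
    and unitary_op_diff: "U (x - y) = U x - U y"
    and unitary_op_scaleC: "U (c *\<^sub>C x) = c *\<^sub>C U x"
proof -
  interpret U: Vector_Spaces.linear scaleC scaleC U
    using assms by (simp add: unitary_op_def clinear_def)
  show "U (x + y) = U x + U y" "U (x - y) = U x - U y" "U (c *\<^sub>C x) = c *\<^sub>C U x"
    by (rule U.add U.diff U.scale)+
qed

lemma unitary_op_continuous: "unitary_op U \<Longrightarrow> continuous_on S U"
  unfolding continuous_on_iff dist_norm
  by (metis unitary_op_diff unitary_op_norm)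

context
  fixes G :: "('g, 'b) monoid_scheme" and \<pi> :: "'g \<Rightarrow> 'h::complex_inner \<Rightarrow> 'h"
  assumes G: "group G" and rep: "unitary_rep G \<pi>"
begin

lemma rep_unitary: "g \<in> carrier G \<Longrightarrow> unitary_op (\<pi> g)"
  using rep by (simp add: unitary_rep_def)

lemma rep_mult: "g \<in> carrier G \<Longrightarrow> h \<in> carrier G \<Longrightarrow> \<pi> (g \<otimes>\<^bsub>G\<^esub> h) x = \<pi> g (\<pi> h x)"
  using rep by (simp add: unitary_rep_def)

lemma rep_one: "\<pi> \<one>\<^bsub>G\<^esub> x = x"
proof -
  interpret group G by (rule G)
  obtain y where "x = \<pi> \<one>\<^bsub>G\<^esub> y" using rep_unitary[OF one_closed] unfolding unitary_op_def by (metis surjD)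
  then show ?thesis using rep_mult[OF one_closed one_closed, of y] by simp
qed

lemma rep_adjoint:
  assumes g: "g \<in> carrier G"
  shows "cinner (\<pi> (inv\<^bsub>G\<^esub> g) x) y = cinner x (\<pi> g y)"
proof -
  interpret group G by (rule G)
  have "cinner (\<pi> (inv\<^bsub>G\<^esub> g) x) y = cinner (\<pi> g (\<pi> (inv\<^bsub>G\<^esub> g) x)) (\<pi> g y)"
    using rep_unitary[OF g] by (simp add: unitary_op_def)
  also have "\<pi> g (\<pi> (inv\<^bsub>G\<^esub> g) x) = x"
    using rep_mult[of g "inv\<^bsub>G\<^esub> g" x] g rep_one by simp
  finally show ?thesis .
qed

lemma rep_adjoint':
  assumes g: "g \<in> carrier G"
  shows "cinner (\<pi> g x) y = cinner x (\<pi> (inv\<^bsub>G\<^esub> g) y)"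
  using rep_adjoint[OF g, of y x] cinner_commute[of _ y] cinner_commute[of x] by simp

lemma compression_in_operators_on:
  assumes "findim_subspace E" "g \<in> carrier G"
  shows "compression E (\<pi> g) \<in> operators_on E"
  using complex_vector.subspace_add[OF subspace_findim[OF assms(1)]]
    complex_vector.subspace_scale[OF subspace_findim[OF assms(1)]] assms rep_unitary[OF assms(2)]
  by (auto simp: operators_on_def compression_def orth_proj_in orth_proj_add orth_proj_scaleC
      unitary_op_add unitary_op_scaleC)

lemma compression_adjoint:
  assumes E: "findim_subspace E" and g: "g \<in> carrier G"
  shows "is_adjoint E (compression E (\<pi> (inv\<^bsub>G\<^esub> g))) (compression E (\<pi> g))"
  unfolding is_adjoint_def
proof (intro ballI)
  fix x y assume xy: "x \<in> E" "y \<in> E"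
  have fixed: "orth_proj E z = z" if "z \<in> E" for z
    using that cinner_diff_right[of _ z z] by (intro orth_proj_unique[OF E]) simp_all
  show "cinner (compression E (\<pi> (inv\<^bsub>G\<^esub> g)) x) y = cinner x (compression E (\<pi> g) y)"
    using xy by (simp add: compression_def cinner_orth_proj[OF E] fixed rep_adjoint[OF g])
      (simp add: cinner_orth_proj[OF E, symmetric] fixed)
qed

text \<open>The defect of multiplicativity measures what \<open>\<pi> h\<close> moves out of \<open>E\<close>.\<close>

lemma mult_defect_compression:
  assumes E: "findim_subspace E" and gh: "g \<in> carrier G" "h \<in> carrier G" and x: "x \<in> E"
  shows "mult_defect G (\<lambda>g. compression E (\<pi> g)) g h x
    = orth_proj E (\<pi> g (orth_compl_proj E (\<pi> h x)))"
  using x by (simp add: mult_defect_def compression_def orth_proj_in[OF E] rep_mult[OF gh]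
      unitary_op_diff[OF rep_unitary[OF gh(1)]] orth_proj_diff[OF E])

end


section \<open>Asymptotic multiplicativity of the compressed pair\<close>

locale compact_pair_filtration = dense_filtration L
  for L :: "nat \<Rightarrow> 'h::complex_inner set" +
  fixes G :: "('g, 'b) monoid_scheme" and \<pi>p \<pi>m :: "'g \<Rightarrow> 'h \<Rightarrow> 'h"
  assumes G: "group G"
    and rep_p: "unitary_rep G \<pi>p" and rep_m: "unitary_rep G \<pi>m"
    and compact_diff: "g \<in> carrier G \<Longrightarrow> compact_op (\<lambda>x. \<pi>p g x - \<pi>m g x)"
begin

abbreviation "D g x \<equiv> \<pi>p g x - \<pi>m g x"
abbreviation "cp n g \<equiv> compression (L n) (\<pi>p g)"
abbreviation "cm n g \<equiv> compression (L n) (\<pi>m g)"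


lemma compact_image_diff:
  assumes "g \<in> carrier G"
  obtains C where "compact C" "\<And>x. norm x \<le> 1 \<Longrightarrow> D g x \<in> C"
proof
  show "compact (closure (D g ` cball 0 1))"
    using compact_diff[OF assms] by (simp add: compact_op_def)
  show "D g x \<in> closure (D g ` cball 0 1)" if "norm x \<le> 1" for x
    using that by (intro subsetD[OF closure_subset] imageI) simp
qed

lemma compact_image_rep_diff:
  assumes "unitary_rep G \<pi>" "g \<in> carrier G" "h \<in> carrier G"
  obtains C where "compact C" "\<And>x. norm x \<le> 1 \<Longrightarrow> \<pi> h (D g x) \<in> C"
proof -
  obtain C where C: "compact C" "\<And>x. norm x \<le> 1 \<Longrightarrow> D g x \<in> C"
    using compact_image_diff assms(2) by blast
  show ?thesis
  proof
    show "compact (\<pi> h ` C)"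
      by (intro compact_continuous_image C unitary_op_continuous rep_unitary[OF G assms(1,3)])
  qed (use C(2) in blast)
qed

lemma compl_proj_rep_diff_null:
  assumes "unitary_rep G \<pi>" "g \<in> carrier G" "h \<in> carrier G"
  obtains \<delta> where "\<delta> \<longlonglongrightarrow> 0" "\<And>n x. norm x \<le> 1 \<Longrightarrow> norm (Q n (\<pi> h (D g x))) \<le> \<delta> n"
proof -
  obtain C where C: "compact C" "\<And>x. norm x \<le> 1 \<Longrightarrow> \<pi> h (D g x) \<in> C"
    using compact_image_rep_diff[OF assms] by blast
  from compl_proj_null_on_compact[OF C(1)] C(2) that show ?thesis by metis
qed

lemma compl_proj_diff_null:
  assumes "g \<in> carrier G"
  obtains \<delta> where "\<delta> \<longlonglongrightarrow> 0" "\<And>n x. norm x \<le> 1 \<Longrightarrow> norm (Q n (D g x)) \<le> \<delta> n"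
proof -
  obtain C where C: "compact C" "\<And>x. norm x \<le> 1 \<Longrightarrow> D g x \<in> C"
    using compact_image_diff[OF assms] by blast
  from compl_proj_null_on_compact[OF C(1)] C(2) that show ?thesis by metis
qed

lemma diff_adjoint:
  assumes "g \<in> carrier G"
  shows "cinner (D g x) y = cinner x (D (inv\<^bsub>G\<^esub> g) y)"
  by (simp add: cinner_diff_left cinner_diff_right rep_adjoint'[OF G rep_p assms]
      rep_adjoint'[OF G rep_m assms])

lemma diff_compl_proj_null:
  assumes g: "g \<in> carrier G"
  obtains \<delta> where "\<delta> \<longlonglongrightarrow> 0" "\<And>n x. norm x \<le> 1 \<Longrightarrow> norm (D g (Q n x)) \<le> \<delta> n"
proof -
  interpret group G by (rule G)
  obtain C where C: "compact C" "\<And>x. norm x \<le> 1 \<Longrightarrow> D (inv\<^bsub>G\<^esub> g) x \<in> C"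
    using compact_image_diff inv_closed[OF g] by blast
  from null_after_compl_proj[OF C diff_adjoint[OF g]] that show ?thesis by blast
qed

lemma diff_rep_compl_proj_null:
  assumes \<pi>: "unitary_rep G \<pi>" and g: "g \<in> carrier G" and h: "h \<in> carrier G"
  obtains \<delta> where "\<delta> \<longlonglongrightarrow> 0" "\<And>n x. norm x \<le> 1 \<Longrightarrow> norm (D g (\<pi> h (Q n x))) \<le> \<delta> n"
proof -
  interpret group G by (rule G)
  obtain C where C: "compact C" "\<And>x. norm x \<le> 1 \<Longrightarrow> \<pi> (inv\<^bsub>G\<^esub> h) (D (inv\<^bsub>G\<^esub> g) x) \<in> C"
    using compact_image_rep_diff[OF \<pi> inv_closed[OF g] inv_closed[OF h]] by blast
  have "cinner (D g (\<pi> h x)) y = cinner x (\<pi> (inv\<^bsub>G\<^esub> h) (D (inv\<^bsub>G\<^esub> g) y))" for x y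
    unfolding diff_adjoint[OF g] rep_adjoint'[OF G \<pi> h] ..
  from null_after_compl_proj[OF C this] that show ?thesis by blast
qed

lemma norm_defect_le:
  assumes "unitary_rep G \<pi>" "g \<in> carrier G" "h \<in> carrier G" "x \<in> L n"
  shows "norm (mult_defect G (\<lambda>g. compression (L n) (\<pi> g)) g h x) \<le> norm (Q n (\<pi> h x))"
  unfolding mult_defect_compression[OF G assms(1) findim assms(2-)]
  using norm_orth_proj_le[OF findim, of n "\<pi> g (Q n (\<pi> h x))"]
    by (simp add: unitary_op_norm[OF rep_unitary[OF G assms(1,2)]])

text \<open>The defect contains the factor \<open>Q n \<circ> \<pi> h\<close>. It is applied to \<open>P n \<circ> D \<gamma>\<close>, where the
  projection may be removed at the cost of \<open>Q n \<circ> D \<gamma>\<close>; compactness of \<open>\<pi> h \<circ> D \<gamma>\<close> and of \<open>D \<gamma>\<close>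
  makes both parts vanish.\<close>

lemma defect_diff_tendsto_0:
  assumes \<pi>: "unitary_rep G \<pi>"
    and g: "g \<in> carrier G" and h: "h \<in> carrier G" and \<gamma>: "\<gamma> \<in> carrier G"
  shows "(\<lambda>n. op_norm (L n) (\<lambda>x. mult_defect G (\<lambda>g. compression (L n) (\<pi> g)) g h
           (cp n \<gamma> x - cm n \<gamma> x))) \<longlonglongrightarrow> 0"
proof -
  obtain \<delta> where \<delta>: "\<delta> \<longlonglongrightarrow> 0" "\<And>n x. norm x \<le> 1 \<Longrightarrow> norm (Q n (\<pi> h (D \<gamma> x))) \<le> \<delta> n"
    using compl_proj_rep_diff_null[OF \<pi> \<gamma> h] by blast
  obtain \<eta> where \<eta>: "\<eta> \<longlonglongrightarrow> 0" "\<And>n x. norm x \<le> 1 \<Longrightarrow> norm (Q n (D \<gamma> x)) \<le> \<eta> n"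
    using compl_proj_diff_null[OF \<gamma>] by blast
  note U = rep_unitary[OF G \<pi> h]
  show ?thesis
  proof (rule op_norm_tendsto_0[where c = "\<lambda>n. \<delta> n + \<eta> n"])
    fix n x assume x: "x \<in> L n" "norm x \<le> 1"
    have "cp n \<gamma> x - cm n \<gamma> x = P n (D \<gamma> x)"
      using x by (simp add: compression_def orth_proj_diff findim)
    then have "norm (mult_defect G (\<lambda>g. compression (L n) (\<pi> g)) g h (cp n \<gamma> x - cm n \<gamma> x))
        \<le> norm (Q n (\<pi> h (P n (D \<gamma> x))))"
      using norm_defect_le[OF \<pi> g h orth_proj_in[OF findim]] by simp
    also have "\<pi> h (P n (D \<gamma> x)) = \<pi> h (D \<gamma> x) - \<pi> h (Q n (D \<gamma> x))"
      by (simp add: unitary_op_diff[OF U])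
    also have "norm (Q n \<dots>) \<le> norm (Q n (\<pi> h (D \<gamma> x))) + norm (\<pi> h (Q n (D \<gamma> x)))"
      by (rule norm_orth_compl_proj_triangle[OF findim])
    also have "\<dots> \<le> \<delta> n + \<eta> n"
      unfolding unitary_op_norm[OF U] by (intro add_mono \<delta>(2) \<eta>(2) x)
    finally show "norm (mult_defect G (\<lambda>g. compression (L n) (\<pi> g)) g h (cp n \<gamma> x - cm n \<gamma> x))
        \<le> \<delta> n + \<eta> n" .
  qed (use findim tendsto_add_zero[OF \<delta>(1) \<eta>(1)] in auto)
qed

text \<open>Telescoping \<open>\<pi>p g Q (\<pi>p h) - \<pi>m g Q (\<pi>m h) = D g Q (\<pi>p h) + \<pi>m g Q (D h)\<close> leaves a compact
  factor next to the projection \<open>Q\<close> in each term.\<close>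

lemma defects_close:
  assumes g: "g \<in> carrier G" and h: "h \<in> carrier G"
  obtains \<delta> where "\<delta> \<longlonglongrightarrow> 0"
    "\<And>n x. x \<in> L n \<Longrightarrow> norm x \<le> 1 \<Longrightarrow> norm (mult_defect G (cp n) g h x - mult_defect G (cm n) g h x) \<le> \<delta> n"
proof -
  obtain \<delta> where \<delta>: "\<delta> \<longlonglongrightarrow> 0" "\<And>n x. norm x \<le> 1 \<Longrightarrow> norm (D g (Q n x)) \<le> \<delta> n"
    using diff_compl_proj_null[OF g] by blast
  obtain \<eta> where \<eta>: "\<eta> \<longlonglongrightarrow> 0" "\<And>n x. norm x \<le> 1 \<Longrightarrow> norm (Q n (D h x)) \<le> \<eta> n"
    using compl_proj_diff_null[OF h] by blast
  note Ug = rep_unitary[OF G rep_m g] and Uh = rep_unitary[OF G rep_p h]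
  have "norm (mult_defect G (cp n) g h x - mult_defect G (cm n) g h x) \<le> \<delta> n + \<eta> n"
    if x: "x \<in> L n" "norm x \<le> 1" for n x
  proof -
    have "mult_defect G (cp n) g h x - mult_defect G (cm n) g h x
        = P n (\<pi>p g (Q n (\<pi>p h x)) - \<pi>m g (Q n (\<pi>m h x)))"
      unfolding mult_defect_compression[OF G rep_p findim g h x(1)]
        mult_defect_compression[OF G rep_m findim g h x(1)]
      by (simp add: orth_proj_diff findim)
    also have "\<pi>p g (Q n (\<pi>p h x)) - \<pi>m g (Q n (\<pi>m h x))
        = D g (Q n (\<pi>p h x)) + \<pi>m g (Q n (D h x))"
      by (simp add: orth_proj_diff findim unitary_op_diff[OF Ug])
    finally have "norm (mult_defect G (cp n) g h x - mult_defect G (cm n) g h x)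
        \<le> norm (D g (Q n (\<pi>p h x)) + \<pi>m g (Q n (D h x)))"
      using norm_orth_proj_le[OF findim] by simp
    also have "\<dots> \<le> norm (D g (Q n (\<pi>p h x))) + norm (\<pi>m g (Q n (D h x)))"
      by (rule norm_triangle_ineq)
    also have "\<dots> \<le> \<delta> n + \<eta> n"
      unfolding unitary_op_norm[OF Ug]
      by (intro add_mono \<delta>(2) \<eta>(2)) (simp_all add: unitary_op_norm[OF Uh] x)
    finally show ?thesis .
  qed
  then show ?thesis using that tendsto_add_zero[OF \<delta>(1) \<eta>(1)] by blast
qed

lemma defects_difference_tendsto_0:
  assumes "g \<in> carrier G" "h \<in> carrier G"
  shows "(\<lambda>n. op_norm (L n) (\<lambda>x. mult_defect G (cp n) g h x - mult_defect G (cm n) g h x))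
    \<longlonglongrightarrow> 0"
proof -
  obtain \<delta> where \<delta>: "\<delta> \<longlonglongrightarrow> 0"
    "\<And>n x. x \<in> L n \<Longrightarrow> norm x \<le> 1 \<Longrightarrow> norm (mult_defect G (cp n) g h x - mult_defect G (cm n) g h x) \<le> \<delta> n"
    using defects_close[OF assms] by blast
  show ?thesis by (rule op_norm_tendsto_0[OF findim \<delta>(2,1)])
qed

text \<open>Here the defects are compared after applying \<open>\<pi>p k\<close>, so that only \<open>D k\<close> applied to one defect
  \<open>P (\<pi>m g) Q (\<pi>m h)\<close> remains; replacing \<open>P\<close> by \<open>1 - Q\<close> again puts \<open>Q\<close> behind one of the compact
  operators \<open>D k \<circ> \<pi>m g\<close> and \<open>D k\<close>.\<close>

lemma shifted_defects_difference_tendsto_0: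
  assumes g: "g \<in> carrier G" and h: "h \<in> carrier G" and k: "k \<in> carrier G"
  shows "(\<lambda>n. op_norm (L n) (\<lambda>x. cp n k (mult_defect G (cp n) g h x)
           - cm n k (mult_defect G (cm n) g h x))) \<longlonglongrightarrow> 0"
proof -
  obtain \<delta> where \<delta>: "\<delta> \<longlonglongrightarrow> 0"
    "\<And>n x. x \<in> L n \<Longrightarrow> norm x \<le> 1 \<Longrightarrow> norm (mult_defect G (cp n) g h x - mult_defect G (cm n) g h x) \<le> \<delta> n"
    using defects_close[OF g h] by blast
  obtain \<eta> where \<eta>: "\<eta> \<longlonglongrightarrow> 0" "\<And>n x. norm x \<le> 1 \<Longrightarrow> norm (D k (\<pi>m g (Q n x))) \<le> \<eta> n"
    using diff_rep_compl_proj_null[OF rep_m k g] by blast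
  obtain \<theta> where \<theta>: "\<theta> \<longlonglongrightarrow> 0" "\<And>n x. norm x \<le> 1 \<Longrightarrow> norm (D k (Q n x)) \<le> \<theta> n"
    using diff_compl_proj_null[OF k] by blast
  note Up = rep_unitary[OF G rep_p k] and Um = rep_unitary[OF G rep_m k]
    and Ug = rep_unitary[OF G rep_m g] and Uh = rep_unitary[OF G rep_m h]
  show ?thesis
  proof (rule op_norm_tendsto_0[where c = "\<lambda>n. \<delta> n + (\<eta> n + \<theta> n)"])
    fix n x assume x: "x \<in> L n" "norm x \<le> 1"
    define a where "a = mult_defect G (cp n) g h x"
    define b where "b = mult_defect G (cm n) g h x"
    define w where "w = \<pi>m g (Q n (\<pi>m h x))"
    have a: "a \<in> L n"
      unfolding a_def mult_defect_compression[OF G rep_p findim g h x(1)] by (rule orth_proj_in[OF findim])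
    have b_eq: "b = P n w"
      unfolding b_def w_def by (rule mult_defect_compression[OF G rep_m findim g h x(1)])
    then have b: "b \<in> L n" by (simp add: orth_proj_in[OF findim])
    have hx: "norm (\<pi>m h x) \<le> 1" using x by (simp add: unitary_op_norm[OF Uh])
    have w: "norm w \<le> 1"
      unfolding w_def unitary_op_norm[OF Ug] using norm_orth_compl_proj_le[OF findim] hx order_trans by blast
    have "cp n k a - cm n k b = P n (\<pi>p k a - \<pi>m k b)"
      using a b by (simp add: compression_def orth_proj_diff findim)
    also have "\<pi>p k a - \<pi>m k b = \<pi>p k (a - b) + D k b" by (simp add: unitary_op_diff[OF Up])
    also have "D k b = D k w - D k (Q n w)"
      by (simp add: b_eq unitary_op_diff[OF Up] unitary_op_diff[OF Um])
    finally have "norm (cp n k a - cm n k b) \<le> norm (\<pi>p k (a - b) + (D k w - D k (Q n w)))"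
      using norm_orth_proj_le[OF findim] by simp
    also have "\<dots> \<le> norm (\<pi>p k (a - b)) + (norm (D k w) + norm (D k (Q n w)))"
      by (intro norm_triangle_le add_left_mono norm_triangle_ineq4)
    also have "\<dots> \<le> \<delta> n + (\<eta> n + \<theta> n)"
    proof (intro add_mono)
      show "norm (\<pi>p k (a - b)) \<le> \<delta> n"
        unfolding unitary_op_norm[OF Up] a_def b_def by (rule \<delta>(2)[OF x])
      show "norm (D k w) \<le> \<eta> n" unfolding w_def by (rule \<eta>(2)[OF hx])
      show "norm (D k (Q n w)) \<le> \<theta> n" by (rule \<theta>(2)[OF w])
    qed
    finally show "norm (cp n k (mult_defect G (cp n) g h x) - cm n k (mult_defect G (cm n) g h x))
        \<le> \<delta> n + (\<eta> n + \<theta> n)"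
      unfolding a_def b_def .
  qed (use findim tendsto_add_zero[OF \<delta>(1) tendsto_add_zero[OF \<eta>(1) \<theta>(1)]] in auto)
qed

lemma operator_pair_compression:
  assumes "F \<subseteq> carrier G"
  shows "operator_pair G (L n) F (cp n) (cm n)"
  using assms findim compression_in_operators_on[OF G] compression_adjoint[OF G] rep_p rep_m
  unfolding operator_pair_def by blast

theorem asymptotically_admissible_compressions:
  "asymptotically_admissible G L cp cm"
  unfolding asymptotically_admissible_def
proof (intro allI impI)
  fix F assume F: "finite F \<and> F \<subseteq> carrier G"
  define A where "A \<pi> g h \<gamma> n = op_norm (L n) (\<lambda>x. mult_defect G (\<lambda>g. compression (L n) (\<pi> g)) g h
    (cp n \<gamma> x - cm n \<gamma> x))" for \<pi> g h \<gamma> n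
  have "\<exists>\<epsilon>. (\<forall>n. \<epsilon> n > 0) \<and> \<epsilon> \<longlonglongrightarrow> 0 \<and>
      (\<forall>n. \<forall>i \<in> {\<pi>p, \<pi>m} \<times> F \<times> F \<times> F. (case i of (\<pi>, g, h, \<gamma>) \<Rightarrow> A \<pi> g h \<gamma>) n < \<epsilon> n)"
  proof (rule common_null_bound)
    fix i assume i: "i \<in> {\<pi>p, \<pi>m} \<times> F \<times> F \<times> F"
    obtain \<pi> g h \<gamma> where [simp]: "i = (\<pi>, g, h, \<gamma>)" by (cases i)
    have "unitary_rep G \<pi>" "g \<in> carrier G" "h \<in> carrier G" "\<gamma> \<in> carrier G"
      using i F rep_p rep_m by auto
    then have "A \<pi> g h \<gamma> \<longlonglongrightarrow> 0" unfolding A_def by (rule defect_diff_tendsto_0)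
    then show "(case i of (\<pi>, g, h, \<gamma>) \<Rightarrow> A \<pi> g h \<gamma>) \<longlonglongrightarrow> 0" by simp
  qed (use F in simp)
  then obtain \<epsilon> where "\<And>n. \<epsilon> n > 0" "\<epsilon> \<longlonglongrightarrow> 0" and
    A: "\<And>n \<pi> g h \<gamma>. \<pi> \<in> {\<pi>p, \<pi>m} \<Longrightarrow> g \<in> F \<Longrightarrow> h \<in> F \<Longrightarrow> \<gamma> \<in> F \<Longrightarrow> A \<pi> g h \<gamma> n < \<epsilon> n"
    by fastforce
  moreover have "admissible G (L n) F (\<epsilon> n) (cp n) (cm n)" for n
    using A[of \<pi>p _ _ _ n] A[of \<pi>m _ _ _ n] F operator_pair_compression
    unfolding admissible_def A_def by simp
  ultimately show "\<exists>\<epsilon>. (\<forall>n. \<epsilon> n > 0) \<and> \<epsilon> \<longlonglongrightarrow> 0 \<and> (\<forall>n. admissible G (L n) F (\<epsilon> n) (cp n) (cm n))"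
    by blast
qed

theorem asymptotically_balanced_compressions:
  "asymptotically_balanced G L cp cm"
  unfolding asymptotically_balanced_def
proof (intro allI impI)
  fix F assume F: "finite F \<and> F \<subseteq> carrier G"
  define A where "A g h n =
    op_norm (L n) (\<lambda>x. mult_defect G (cp n) g h x - mult_defect G (cm n) g h x)" for g h n
  define B where "B g h k n = op_norm (L n) (\<lambda>x. cp n k (mult_defect G (cp n) g h x)
    - cm n k (mult_defect G (cm n) g h x))" for g h k n
  have "\<exists>\<epsilon>. (\<forall>n. \<epsilon> n > 0) \<and> \<epsilon> \<longlonglongrightarrow> 0 \<and>
      (\<forall>n. \<forall>i \<in> F \<times> F \<times> F. (case i of (g, h, k) \<Rightarrow> \<lambda>n. max (A g h n) (B g h k n)) n < \<epsilon> n)"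
  proof (rule common_null_bound)
    fix i assume i: "i \<in> F \<times> F \<times> F"
    obtain g h k where [simp]: "i = (g, h, k)" by (cases i)
    have *: "g \<in> carrier G" "h \<in> carrier G" "k \<in> carrier G" using i F by auto
    have "A g h \<longlonglongrightarrow> 0" unfolding A_def using *(1,2) by (rule defects_difference_tendsto_0)
    moreover have "B g h k \<longlonglongrightarrow> 0"
      unfolding B_def using * by (rule shifted_defects_difference_tendsto_0)
    ultimately have "(\<lambda>n. max (A g h n) (B g h k n)) \<longlonglongrightarrow> 0"
      using tendsto_max[of "A g h" 0 sequentially "B g h k" 0] by simp
    then show "(case i of (g, h, k) \<Rightarrow> \<lambda>n. max (A g h n) (B g h k n)) \<longlonglongrightarrow> 0" by simp
  qed (use F in simp)
  then obtain \<epsilon> where "\<And>n. \<epsilon> n > 0" "\<epsilon> \<longlonglongrightarrow> 0" and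
    AB: "\<And>n g h k. g \<in> F \<Longrightarrow> h \<in> F \<Longrightarrow> k \<in> F \<Longrightarrow> max (A g h n) (B g h k n) < \<epsilon> n"
    by fastforce
  moreover have "balanced G (L n) F (\<epsilon> n) (cp n) (cm n)" for n
    using AB[of _ _ _ n] F operator_pair_compression
    unfolding balanced_def A_def B_def by auto
  ultimately show "\<exists>\<epsilon>. (\<forall>n. \<epsilon> n > 0) \<and> \<epsilon> \<longlonglongrightarrow> 0 \<and> (\<forall>n. balanced G (L n) F (\<epsilon> n) (cp n) (cm n))"
    by blast
qed

end

theorem theorem2:
  fixes G :: "('g, 'b) monoid_scheme"
    and \<pi>p \<pi>m :: "'g \<Rightarrow> 'h::chilbert_space \<Rightarrow> 'h"
    and L :: "nat \<Rightarrow> 'h set"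
  assumes "group G" and "finitely_generated G"
    and "unitary_rep G \<pi>p" and "unitary_rep G \<pi>m"
    and "\<And>g. g \<in> carrier G \<Longrightarrow> compact_op (\<lambda>x. \<pi>p g x - \<pi>m g x)"
    and "\<And>n. complex_vector.subspace (L n)"
    and "\<And>n. complex_vector.dim (L n) = n"
    and "\<And>n. L n \<subseteq> L (Suc n)"
    and "closure (\<Union>n. L n) = UNIV"
  shows "asymptotically_admissible G L
           (\<lambda>n g. compression (L n) (\<pi>p g)) (\<lambda>n g. compression (L n) (\<pi>m g)) \<and>
         asymptotically_balanced G L
           (\<lambda>n g. compression (L n) (\<pi>p g)) (\<lambda>n g. compression (L n) (\<pi>m g))"
proof -
  interpret compact_pair_filtration L G \<pi>p \<pi>m
    by (intro compact_pair_filtration.intro dense_filtration.intro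
        compact_pair_filtration_axioms.intro findim_of_dim assms)
  show ?thesis
    using asymptotically_admissible_compressions asymptotically_balanced_compressions by blast
qed

end
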